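(* Let $R$ be an integral domain, let $A = \prod_{i=1}^n A_i \subset R^n$ be a finite grid, and let $\mathcal{H} = \{H_i\}_{i=1}^d$ be a family of hyperplanes in $R^n$. (a) If $\mathcal{H}$ partially covers $A$, then $\mathcal{H}$ fails to cover at least $\mathfrak{m}(\#A_1,\dots,\#A_n;\sum_{i=1}^n \#A_i - d)$ points of $A$. (b) For all $d \in \mathbb{Z}^+$, there is a family of hyperplanes $\{H_i = t_{j_i} - x_i\}_{i=1}^d$, with $j_i \in [n]$ and $x_i \in A_{j_i}$ for each $i$, which covers all but exactly $\mathfrak{m}(\#A_1,\dots,\#A_n;\sum_{i=1}^n \#A_i - d)$ points of $A$. (c) If $\mathcal{H}$ covers all but exactly one point of $A$, then $d \ge \sum_{i=1}^n (\#A_i - 1)$.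
   Context: $\mathbb{Z}^+$ denotes the positive integers and $[n]=\{1,\dots,n\}$. A finite grid in $R^n$ ($n \in \mathbb{Z}^+$) is a set $A=\prod_{i=1}^n A_i$ with each $A_i \subset R$ finite and nonempty. A hyperplane in $R^n$ is a polynomial $H = c_1t_1+\cdots+c_nt_n + r \in R[t_1,\dots,t_n]$ for which at least one $c_i$ is not a zero divisor (for $R$ a domain: at least one $c_i \neq 0$). An indexed family $\{H_i\}_{i=1}^d$ of hyperplanes covers $x \in R^n$ if $H_i(x)=0$ for some $i \in [d]$; it covers a subset $S \subset R^n$ if it covers every point of $S$, and partially covers $S$ otherwise. For positive integers $a_1,\dots,a_n$ and an integer $N$ with $n \le N \le \sum_{i=1}^n a_i$, $\mathfrak{m}(a_1,\dots,a_n;N)$ is the minimum of $\prod_{i=1}^n y_i$ over all tuples of integers $(y_1,\dots,y_n)$ with $1 \le y_i \le a_i$ for all $i$ and $\sum_{i=1}^n y_i = N$; for $N<n$ one defines $\mathfrak{m}(a_1,\dots,a_n;N)=1$.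
   Formalization: Part (b) is stated only when some A_i has at least two elements: if all A_i are singletons, A is one point, every t_j − x with x in A_j covers it, so 0 points are uncovered while 𝔪 = 1 for every d ≥ 1, and (b) fails. *)

theory Defs
  imports "HOL-Library.Poly_Mapping" "HOL-Library.FuncSet"
begin

text \<open>
  Polynomials in indeterminates \<open>t\<^sub>i\<close> (\<open>i :: nat\<close>) are finitely supported maps from
  exponent vectors to coefficients. Points of \<open>R\<^sup>n\<close> are functions on the index
  set \<open>{1..n}\<close>.
\<close>

type_synonym 'a mpoly = "(nat \<Rightarrow>\<^sub>0 nat) \<Rightarrow>\<^sub>0 'a"

definition pvar :: "nat \<Rightarrow> 'a::comm_semiring_1 mpoly" where
  "pvar i = Poly_Mapping.single (Poly_Mapping.single i 1) 1"

definition pconst :: "'a::comm_semiring_1 \<Rightarrow> 'a mpoly" where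
  "pconst c = Poly_Mapping.single 0 c"

definition peval :: "(nat \<Rightarrow> 'a) \<Rightarrow> 'a::comm_semiring_1 mpoly \<Rightarrow> 'a" where
  "peval x p = (\<Sum>m\<in>Poly_Mapping.keys p.
     Poly_Mapping.lookup p m * (\<Prod>i\<in>Poly_Mapping.keys m. x i ^ Poly_Mapping.lookup m i))"

definition grid :: "nat \<Rightarrow> (nat \<Rightarrow> 'a set) \<Rightarrow> (nat \<Rightarrow> 'a) set" where
  "grid n A = (\<Pi>\<^sub>E i\<in>{1..n}. A i)"

definition hyperplane :: "nat \<Rightarrow> 'a::idom mpoly \<Rightarrow> bool" where
  "hyperplane n H \<longleftrightarrow>
     (\<exists>c r. (\<exists>i\<in>{1..n}. c i \<noteq> 0) \<and> H = (\<Sum>i=1..n. pconst (c i) * pvar i) + pconst r)"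

definition covers_point :: "nat \<Rightarrow> (nat \<Rightarrow> 'a::idom mpoly) \<Rightarrow> (nat \<Rightarrow> 'a) \<Rightarrow> bool" where
  "covers_point d H x \<longleftrightarrow> (\<exists>i\<in>{1..d}. peval x (H i) = 0)"

definition covers :: "nat \<Rightarrow> (nat \<Rightarrow> 'a::idom mpoly) \<Rightarrow> (nat \<Rightarrow> 'a) set \<Rightarrow> bool" where
  "covers d H S \<longleftrightarrow> (\<forall>x\<in>S. covers_point d H x)"

definition partially_covers :: "nat \<Rightarrow> (nat \<Rightarrow> 'a::idom mpoly) \<Rightarrow> (nat \<Rightarrow> 'a) set \<Rightarrow> bool" where
  "partially_covers d H S \<longleftrightarrow> \<not> covers d H S"

definition uncovered :: "nat \<Rightarrow> (nat \<Rightarrow> 'a::idom mpoly) \<Rightarrow> (nat \<Rightarrow> 'a) set \<Rightarrow> (nat \<Rightarrow> 'a) set" where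
  "uncovered d H S = {x \<in> S. \<not> covers_point d H x}"

text \<open>
  \<open>N\<close> is an integer because it is instantiated with a difference that may be negative.
  For \<open>N > (\<Sum>i=1..n. a i)\<close> the minimum is over the empty set, so the value is unspecified.
\<close>

definition min_prod :: "nat \<Rightarrow> (nat \<Rightarrow> nat) \<Rightarrow> int \<Rightarrow> nat" where
  "min_prod n a N =
     (if N < int n then 1
      else Min ((\<lambda>y. \<Prod>i=1..n. y i) `
             {y \<in> (\<Pi>\<^sub>E i\<in>{1..n}. {1..a i}). int (\<Sum>i=1..n. y i) = N}))"

lemma peval_superset:
  assumes "finite S" "Poly_Mapping.keys p \<subseteq> S"
  shows "peval x p = (\<Sum>m\<in>S.
     Poly_Mapping.lookup p m * (\<Prod>i\<in>Poly_Mapping.keys m. x i ^ Poly_Mapping.lookup m i))"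
  unfolding peval_def
  by (rule sum.mono_neutral_left) (use assms in \<open>auto simp: in_keys_iff\<close>)

lemma peval_add: "peval x (p + q) = peval x p + peval x q"
proof -
  let ?S = "Poly_Mapping.keys p \<union> Poly_Mapping.keys q"
  have "Poly_Mapping.keys (p + q) \<subseteq> ?S" by (rule Poly_Mapping.keys_add)
  then show ?thesis
    by (simp add: peval_superset[of ?S] lookup_add distrib_right sum.distrib)
qed

lemma peval_uminus: "peval x (- p) = - peval x (p :: 'a::idom mpoly)"
  by (simp add: peval_def sum_negf)

lemma peval_diff: "peval x (p - q) = peval x p - peval x (q :: 'a::idom mpoly)"
  using peval_add[of x p "- q"] by (simp add: peval_uminus)

lemma peval_pconst: "peval x (pconst c) = c"
  by (simp add: peval_def pconst_def)

lemma peval_pvar: "peval x (pvar i) = x i"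
  by (simp add: peval_def pvar_def)

lemma peval_monom1: "peval x (pconst c * pvar i) = c * x i"
  by (simp add: peval_def pconst_def pvar_def mult_single)

lemma peval_sum: "peval x (\<Sum>i\<in>I. f i) = (\<Sum>i\<in>I. peval x (f i))"
  by (induction I rule: infinite_finite_induct) (simp_all add: peval_add, simp_all add: peval_def)

lemma peval_affine:
  "peval x ((\<Sum>i=1..n. pconst (c i) * pvar i) + pconst r) = (\<Sum>i=1..n. c i * x i) + r"
  by (simp add: peval_add peval_sum peval_monom1 peval_pconst)

end

theory Submission
  imports Defs
begin

text \<open>
  The bound in (a) is the Alon--Fueredi theorem, applied to the product of the hyperplanes, a
  polynomial function \<open>f\<close> of degree at most \<open>d\<close>. Induct on the dimension. Let \<open>B\<close> be the set of
  values of the last coordinate for which the slice of \<open>f\<close> is not identically zero on the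
  remaining grid. The other \<open>k\<close> values give roots that can be divided out of \<open>f\<close>, so that each of
  the \<open>card B\<close> nonzero slices is proportional to a polynomial function of degree at most \<open>d - k\<close>,
  to which the induction hypothesis applies. For (b), remove superfluous coordinate values from
  each factor so as to leave a subgrid with an optimal vector of side lengths.
\<close>

section \<open>Polynomial functions of bounded total degree\<close>

text \<open>Only values on a grid matter, so functions stand in for formal polynomials. The index is
  an upper bound on the total degree, not the degree itself; inductions follow the way a function is
  built from constants, sums and multiplication by a coordinate.\<close>

inductive poly_fun :: "nat \<Rightarrow> ((nat \<Rightarrow> 'a::comm_ring_1) \<Rightarrow> 'a) \<Rightarrow> bool" where
  const: "poly_fun d (\<lambda>x. c)"
| add: "poly_fun d f \<Longrightarrow> poly_fun d g \<Longrightarrow> poly_fun d (\<lambda>x. f x + g x)"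
| var_mult: "poly_fun d f \<Longrightarrow> poly_fun (Suc d) (\<lambda>x. x i * f x)"

lemma poly_fun_Suc: "poly_fun d f \<Longrightarrow> poly_fun (Suc d) f"
  by (induction rule: poly_fun.induct) (auto intro: poly_fun.intros)

lemma poly_fun_scale: "poly_fun d f \<Longrightarrow> poly_fun d (\<lambda>x. c * f x)"
proof (induction rule: poly_fun.induct)
  case (add d f g)
  then show ?case
    using poly_fun.add[OF add.IH] by (simp add: distrib_left)
next
  case (var_mult d f i)
  then show ?case
    using poly_fun.var_mult[OF var_mult.IH, of i] by (simp add: mult.left_commute)
qed (rule poly_fun.const)

text \<open>Each hyperplane factor costs one degree, which is how a product of \<open>d\<close>
  hyperplanes comes to have degree at most \<open>d\<close>.\<close>

lemma poly_fun_affine_mult: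
  assumes "poly_fun d f"
  shows "poly_fun (Suc d) (\<lambda>x. ((\<Sum>i=1..n. c i * x i) + r) * f x)"
proof -
  have "poly_fun (Suc d) (\<lambda>x. (\<Sum>i=1..n. c i * x i) * f x)"
  proof (induction n)
    case 0
    show ?case by (simp add: poly_fun.const)
  next
    case (Suc n)
    have "poly_fun (Suc d) (\<lambda>x. c (Suc n) * (x (Suc n) * f x))"
      by (intro poly_fun_scale poly_fun.var_mult assms)
    from poly_fun.add[OF Suc this] show ?case
      by (simp add: algebra_simps)
  qed
  from poly_fun.add[OF this poly_fun_Suc[OF poly_fun_scale[OF assms, of r]]]
  show ?thesis by (simp add: algebra_simps)
qed

text \<open>The rule \<open>var_mult\<close> never yields the bound 0, so only sums of constants
  remain. This settles the cases where \<open>d - 1\<close> is truncated.\<close>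

lemma poly_fun_0: "poly_fun 0 f \<Longrightarrow> f x = f y"
proof (induction "0::nat" f rule: poly_fun.induct)
  case (add f g)
  then show ?case by metis
qed auto

text \<open>Division with remainder by the monic linear polynomial \<open>x k - b\<close>, carried
  out along the construction of \<open>f\<close>; no cancellation in the ring is involved.\<close>

lemma poly_fun_remainder:
  assumes "poly_fun d f"
  shows "\<exists>q. poly_fun (d - 1) q \<and> (\<forall>x. f x = f (x(k := b)) + (x k - b) * q x)"
  using assms
proof (induction rule: poly_fun.induct)
  case (const d c)
  show ?case by (rule exI[of _ "\<lambda>x. 0"]) (simp add: poly_fun.const)
next
  case (add d f g)
  then obtain p q where p: "poly_fun (d - 1) p" "\<And>x. f x = f (x(k := b)) + (x k - b) * p x"
    and q: "poly_fun (d - 1) q" "\<And>x. g x = g (x(k := b)) + (x k - b) * q x"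
    by blast
  show ?case
  proof (intro exI[of _ "\<lambda>x. p x + q x"] conjI allI)
    show "poly_fun (d - 1) (\<lambda>x. p x + q x)" using p q by (intro poly_fun.add)
    fix x
    show "f x + g x = f (x(k := b)) + g (x(k := b)) + (x k - b) * (p x + q x)"
      by (subst p(2), subst q(2)) (simp add: algebra_simps)
  qed
next
  case (var_mult d f i)
  then obtain q where q: "poly_fun (d - 1) q" "\<And>x. f x = f (x(k := b)) + (x k - b) * q x"
    by blast
  have qd: "poly_fun d q" if "d \<noteq> 0"
    using poly_fun_Suc[OF q(1)] that by simp
  show ?case
  proof (cases "d = 0")
    \<comment> \<open>Here \<open>d - 1 = d\<close>, so the quotient \<open>x i * q x\<close> of the
      general case would exceed the bound. Since \<open>f\<close> is constant, \<open>f\<close> or 0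
      serves instead.\<close>
    case True
    have f: "f x = f y" for x y
      using var_mult.hyps True poly_fun_0 by blast
    show ?thesis
    proof (cases "i = k")
      case i: True
      show ?thesis
      proof (intro exI[of _ f] conjI allI)
        show "poly_fun (Suc d - 1) f" using var_mult.hyps by simp
        fix x
        show "x i * f x = (x(k := b)) i * f (x(k := b)) + (x k - b) * f x"
          using f[of "x(k := b)" x] i by (simp add: algebra_simps)
      qed
    next
      case i: False
      show ?thesis
      proof (intro exI[of _ "\<lambda>x. 0"] conjI allI)
        fix x
        show "x i * f x = (x(k := b)) i * f (x(k := b)) + (x k - b) * 0"
          using f[of "x(k := b)" x] i by simp
      qed (rule poly_fun.const)
    qed
  next
    case False
    show ?thesis
    proof (cases "i = k")
      case i: True
      \<comment> \<open>Split \<open>x k * f x\<close> as \<open>(x k - b) * f x + b * f x\<close>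
        and divide the second summand using \<open>q\<close>.\<close>
      show ?thesis
      proof (intro exI[of _ "\<lambda>x. f x + b * q x"] conjI allI)
        show "poly_fun (Suc d - 1) (\<lambda>x. f x + b * q x)"
          using var_mult.hyps qd[OF False] by (auto intro: poly_fun.add poly_fun_scale)
        fix x
        have "b * f x = b * (f (x(k := b)) + (x k - b) * q x)" using q(2) by metis
        then show "x i * f x = (x(k := b)) i * f (x(k := b)) + (x k - b) * (f x + b * q x)"
          using i by (simp add: algebra_simps)
      qed
    next
      case i: False
      show ?thesis
      proof (intro exI[of _ "\<lambda>x. x i * q x"] conjI allI)
        show "poly_fun (Suc d - 1) (\<lambda>x. x i * q x)"
          using poly_fun.var_mult[OF q(1), of i] False by simp
        fix x
        have "x i * f x = x i * (f (x(k := b)) + (x k - b) * q x)" using q(2) by metis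
        then show "x i * f x = (x(k := b)) i * f (x(k := b)) + (x k - b) * (x i * q x)"
          using i by (simp add: algebra_simps)
      qed
    qed
  qed
qed

text \<open>Slices of a function inherit its degree bound: a frozen coordinate merely acts as a
  scalar.\<close>

lemma poly_fun_upd: "poly_fun d f \<Longrightarrow> poly_fun d (\<lambda>x. f (x(k := b)))"
proof (induction rule: poly_fun.induct)
  case (var_mult d f i)
  show ?case
  proof (cases "i = k")
    case True
    then show ?thesis
      using poly_fun_Suc[OF poly_fun_scale[OF var_mult.IH]] by simp
  next
    case False
    then show ?thesis
      using poly_fun.var_mult[OF var_mult.IH] by simp
  qed
qed (auto intro: poly_fun.intros)

text \<open>Iterated factor theorem. The remainder at \<open>c\<close> vanishes over
  \<open>X\<close>, and the other roots pass to the quotient because differences of distinct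
  elements of a domain cancel. The nonzero value at \<open>z(k := v)\<close> survives each division,
  which keeps the degree from running out.\<close>

lemma poly_fun_divide_roots:
  fixes f :: "(nat \<Rightarrow> 'a::idom) \<Rightarrow> 'a"
  assumes "finite C" "poly_fun d f"
    and "\<And>x c. x \<in> X \<Longrightarrow> c \<in> C \<Longrightarrow> f (x(k := c)) = 0"
    and "z \<in> X" "f (z(k := v)) \<noteq> 0"
  shows "card C \<le> d \<and> (\<exists>q. poly_fun (d - card C) q \<and>
           (\<forall>x\<in>X. \<forall>b. f (x(k := b)) = (\<Prod>c\<in>C. b - c) * q (x(k := b))))"
  using assms
proof (induction C arbitrary: d f rule: finite_induct)
  case empty
  then show ?case by auto
next
  case (insert c C)
  obtain q where q: "poly_fun (d - 1) q" "\<And>x. f x = f (x(k := c)) + (x k - c) * q x"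
    using poly_fun_remainder[OF insert.prems(1)] by blast
  have fc: "f (x(k := b)) = (b - c) * q (x(k := b))" if "x \<in> X" for x b
    using q(2)[of "x(k := b)"] insert.prems(2)[OF that] by simp
  \<comment> \<open>A constant cannot vanish at \<open>c\<close> and not at \<open>v\<close>; hence
    \<open>d - 1\<close> is a true drop in degree.\<close>
  have "d \<noteq> 0"
  proof
    assume "d = 0"
    then have "f (z(k := v)) = f (z(k := c))"
      using insert.prems(1) poly_fun_0 by blast
    then show False using insert.prems by simp
  qed
  have "q (x(k := b)) = 0" if "x \<in> X" "b \<in> C" for x b
  proof -
    have "b \<noteq> c" using that insert.hyps by auto
    then show ?thesis using fc[OF that(1), of b] insert.prems(2) that by auto
  qed
  moreover have "q (z(k := v)) \<noteq> 0"
    using fc[OF insert.prems(3), of v] insert.prems(4) by (metis mult_zero_right)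
  ultimately obtain p where le: "card C \<le> d - 1" and p: "poly_fun (d - 1 - card C) p"
    "\<And>x b. x \<in> X \<Longrightarrow> q (x(k := b)) = (\<Prod>c\<in>C. b - c) * p (x(k := b))"
    using insert.IH[OF q(1) _ insert.prems(3)] by blast
  have "poly_fun (d - card (insert c C)) p"
    using p(1) insert.hyps by simp
  moreover have "f (x(k := b)) = (\<Prod>c\<in>insert c C. b - c) * p (x(k := b))" if "x \<in> X" for x b
    using fc[OF that] p(2)[OF that] insert.hyps by (simp add: mult.assoc)
  moreover have "card (insert c C) \<le> d"
    using le \<open>d \<noteq> 0\<close> insert.hyps by simp
  ultimately show ?case by blast
qed

section \<open>The minimal product\<close>

text \<open>Literally the set in the second branch of \<open>min_prod\<close>, so that it can be
  folded there.\<close>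

definition compositions :: "nat \<Rightarrow> (nat \<Rightarrow> nat) \<Rightarrow> int \<Rightarrow> (nat \<Rightarrow> nat) set" where
  "compositions n a N = {y \<in> (\<Pi>\<^sub>E i\<in>{1..n}. {1..a i}). int (\<Sum>i=1..n. y i) = N}"

lemma finite_compositions: "finite (compositions n a N)"
  unfolding compositions_def by (auto intro!: finite_PiE)

lemma compositions_extend:
  assumes "y \<in> compositions n a N" "1 \<le> v" "v \<le> a (Suc n)"
  shows "y(Suc n := v) \<in> compositions (Suc n) a (N + int v)"
  using assms
  by (auto simp: compositions_def PiE_iff extensional_def)

lemma compositions_nonempty:
  assumes "\<And>i. i \<in> {1..n} \<Longrightarrow> 1 \<le> a i" "int n \<le> N" "N \<le> (\<Sum>i=1..n. int (a i))"
  shows "compositions n a N \<noteq> {}"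
  using assms
proof (induction n arbitrary: N)
  case 0
  then show ?case by (auto simp: compositions_def)
next
  case (Suc n)
  \<comment> \<open>Greedy choice: the largest last entry that leaves at least 1 for each of the
    first \<open>n\<close> entries.\<close>
  define v where "v = (if N \<ge> int n + int (a (Suc n)) then a (Suc n) else nat (N - int n))"
  have v: "1 \<le> v" "v \<le> a (Suc n)"
    using Suc.prems(1)[of "Suc n"] Suc.prems(2) by (auto simp: v_def)
  have "int n \<le> (\<Sum>i=1..n. int (a i))"
    using sum_mono[of "{1..n}" "\<lambda>i. 1::int" "\<lambda>i. int (a i)"] Suc.prems(1) by force
  then have "int n \<le> N - int v" "N - int v \<le> (\<Sum>i=1..n. int (a i))"
    using Suc.prems(2,3) by (auto simp: v_def)
  with Suc.IH Suc.prems(1) obtain y where "y \<in> compositions n a (N - int v)"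
    by fastforce
  from compositions_extend[OF this v] show ?case by auto
qed

lemma compositions_dim_le:
  assumes "y \<in> compositions n a N"
  shows "int n \<le> N"
proof -
  have "(\<Sum>i=1..n. 1) \<le> (\<Sum>i=1..n. y i)"
    using assms by (intro sum_mono) (auto simp: compositions_def PiE_iff)
  moreover have "int (\<Sum>i=1..n. y i) = N" using assms by (simp add: compositions_def)
  ultimately show ?thesis by (simp del: of_nat_sum)
qed

lemma min_prod_le:
  assumes "y \<in> compositions n a N"
  shows "min_prod n a N \<le> (\<Prod>i=1..n. y i)"
  using assms finite_compositions[of n a N] compositions_dim_le[OF assms]
  unfolding min_prod_def compositions_def by (auto intro!: Min_le)

lemma min_prod_attained:
  assumes "\<And>i. i \<in> {1..n} \<Longrightarrow> 1 \<le> a i" "int n \<le> N" "N \<le> (\<Sum>i=1..n. int (a i))"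
  obtains y where "y \<in> compositions n a N" "min_prod n a N = (\<Prod>i=1..n. y i)"
proof -
  have "min_prod n a N \<in> (\<lambda>y. \<Prod>i=1..n. y i) ` compositions n a N"
    using assms(2) finite_compositions[of n a N] compositions_nonempty[OF assms]
    unfolding min_prod_def compositions_def[symmetric] by (auto intro!: Min_in)
  then show ?thesis using that by blast
qed

text \<open>Append \<open>v\<close> to an optimal tuple for \<open>N - int v\<close>. The last
  hypothesis keeps that inner minimum off the empty set. This is the recursion matched by counting
  \<open>v\<close> nonzero slices.\<close>

lemma min_prod_Suc_le:
  assumes "\<And>i. i \<in> {1..Suc n} \<Longrightarrow> 1 \<le> a i"
    and "1 \<le> v" "v \<le> a (Suc n)" "N - int v \<le> (\<Sum>i=1..n. int (a i))"
  shows "min_prod (Suc n) a N \<le> v * min_prod n a (N - int v)"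
proof (cases "int n \<le> N - int v")
  case True
  have "1 \<le> a i" if "i \<in> {1..n}" for i using assms(1) that by simp
  from min_prod_attained[of n a, OF this True assms(4)] obtain y
    where y: "y \<in> compositions n a (N - int v)" "min_prod n a (N - int v) = (\<Prod>i=1..n. y i)"
    by blast
  show ?thesis
    using min_prod_le[OF compositions_extend[of y n a "N - int v" v, OF y(1) assms(2,3)]] y(2)
    by (simp add: mult.commute)
next
  case low: False
  then have m: "min_prod n a (N - int v) = 1" by (simp add: min_prod_def)
  show ?thesis
  proof (cases "int (Suc n) \<le> N")
    case True
    \<comment> \<open>The inner minimum is the default 1, which stands for the all-ones tuple; the
      last entry shrinks from \<open>v\<close> to \<open>w\<close> to restore the sum
      \<open>N\<close>.\<close>
    define w where "w = nat (N - int n)"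
    have w: "1 \<le> w" "w \<le> v" "int n + int w = N" using True low by (auto simp: w_def)
    have "restrict (\<lambda>i. 1) {1..n} \<in> compositions n a (int n)"
      using assms(1) by (simp add: compositions_def PiE_iff)
    from compositions_extend[OF this, of w] w assms
    have "(restrict (\<lambda>i. 1) {1..n})(Suc n := w) \<in> compositions (Suc n) a N" by simp
    from min_prod_le[OF this] show ?thesis using w m by simp
  next
    case False
    then show ?thesis using assms m by (simp add: min_prod_def)
  qed
qed

text \<open>A sum larger than the number of entries forces some entry to be at least 2, while all
  others are at least 1.\<close>

lemma min_prod_ge_2:
  assumes "\<And>i. i \<in> {1..n} \<Longrightarrow> 1 \<le> a i" "int n < N" "N \<le> (\<Sum>i=1..n. int (a i))"
  shows "2 \<le> min_prod n a N"
proof -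
  obtain y where y: "y \<in> compositions n a N" "min_prod n a N = (\<Prod>i=1..n. y i)"
    using min_prod_attained[of n a N] assms by auto
  then have ge: "1 \<le> y i" if "i \<in> {1..n}" for i
    using that by (auto simp: compositions_def PiE_iff)
  have "\<exists>i\<in>{1..n}. 2 \<le> y i"
  proof (rule ccontr)
    assume "\<not> ?thesis"
    then have "y i \<le> 1" if "i \<in> {1..n}" for i
      using that by (metis not_less_eq_eq numeral_2_eq_2 One_nat_def)
    then have "(\<Sum>i=1..n. y i) \<le> (\<Sum>i=1..n. 1)" by (rule sum_mono)
    moreover have "int (\<Sum>i=1..n. y i) = N" using y by (simp add: compositions_def)
    ultimately show False using assms by (simp del: of_nat_sum)
  qed
  then obtain i where i: "i \<in> {1..n}" "2 \<le> y i" by blast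
  have "y i * 1 \<le> y i * (\<Prod>j\<in>{1..n} - {i}. y j)"
    using ge by (intro mult_left_mono prod_ge_1) auto
  also have "\<dots> = (\<Prod>i=1..n. y i)" using i by (simp add: prod.remove)
  finally show ?thesis using i y by simp
qed

section \<open>Counting nonzeros on grids\<close>

lemma finite_grid: "(\<And>i. i \<in> {1..n} \<Longrightarrow> finite (A i)) \<Longrightarrow> finite (grid n A)"
  unfolding grid_def by (intro finite_PiE) auto

text \<open>Fibre the grid over its last coordinate. Points of \<open>grid n A\<close> are
  \<open>undefined\<close> at \<open>Suc n\<close>, so overwriting that value loses nothing.\<close>

lemma card_nonzeros_Suc:
  assumes "\<And>i. i \<in> {1..Suc n} \<Longrightarrow> finite (A i)"
  shows "card {x \<in> grid (Suc n) A. f x \<noteq> 0} =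
    (\<Sum>b\<in>A (Suc n). card {x \<in> grid n A. f (x(Suc n := b)) \<noteq> 0})"
proof -
  let ?S = "SIGMA b:A (Suc n). {x \<in> grid n A. f (x(Suc n := b)) \<noteq> 0}"
  let ?h = "\<lambda>(b, x). x(Suc n := b)"
  have I: "{1..Suc n} = insert (Suc n) {1..n}" by auto
  have "grid (Suc n) A = ?h ` (A (Suc n) \<times> grid n A)"
    unfolding grid_def I PiE_insert_eq by simp
  then have "{x \<in> grid (Suc n) A. f x \<noteq> 0} = ?h ` ?S" by auto
  moreover have "inj_on ?h ?S"
  proof (rule inj_onI, clarify)
    fix b x b' x'
    assume x: "x \<in> grid n A" "x' \<in> grid n A" and eq: "x(Suc n := b) = x'(Suc n := b')"
    have "x i = x' i" for i
      using x fun_cong[OF eq, of i]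
      by (cases "i = Suc n") (auto simp: grid_def PiE_iff extensional_def)
    then show "b = b' \<and> x = x'" using fun_cong[OF eq, of "Suc n"] by auto
  qed
  ultimately have "card {x \<in> grid (Suc n) A. f x \<noteq> 0} = card ?S"
    by (simp add: card_image)
  then show ?thesis
    using assms finite_grid[of n A] by (subst (asm) card_SigmaI) auto
qed

theorem alon_fueredi:
  fixes f :: "(nat \<Rightarrow> 'a::idom) \<Rightarrow> 'a"
  assumes "\<And>i. i \<in> {1..n} \<Longrightarrow> finite (A i) \<and> A i \<noteq> {}"
    and "poly_fun d f" "z \<in> grid n A" "f z \<noteq> 0"
  shows "min_prod n (\<lambda>i. card (A i)) ((\<Sum>i=1..n. int (card (A i))) - int d)
    \<le> card {x \<in> grid n A. f x \<noteq> 0}"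
  using assms
proof (induction n arbitrary: d f z)
  case 0
  \<comment> \<open>For \<open>d = 0\<close> the empty tuple has product 1; for \<open>d > 0\<close>
    the sum is negative and the default 1 applies.\<close>
  have "min_prod 0 (\<lambda>i. card (A i)) (- int d) \<le> 1"
    using min_prod_le[of "\<lambda>i. undefined" 0 "\<lambda>i. card (A i)" 0]
    by (cases "d = 0") (auto simp: compositions_def min_prod_def)
  moreover have "{x \<in> grid 0 A. f x \<noteq> 0} = {z}"
    using "0.prems" by (auto simp: grid_def)
  ultimately show ?case by simp
next
  case (Suc n)
  let ?k = "Suc n" and ?X = "grid n A"
  have fin: "finite (A i)" "A i \<noteq> {}" if "i \<in> {1..Suc n}" for i
    using Suc.prems(1)[OF that] by auto
  define B where "B = {b \<in> A ?k. \<exists>x\<in>?X. f (x(?k := b)) \<noteq> 0}"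
  define C where "C = A ?k - B"
  have finB: "finite B" "finite C" "B \<subseteq> A ?k"
    using fin[of ?k] by (auto simp: B_def C_def)
  have cardA: "card (A ?k) = card B + card C"
    using finB by (simp add: C_def card_Diff_subset card_mono fin)
  have C0: "f (x(?k := c)) = 0" if "x \<in> ?X" "c \<in> C" for x c
    using that by (auto simp: B_def C_def)
  have I: "{1..Suc n} = insert (Suc n) {1..n}" by auto
  obtain z' v where z': "z' \<in> ?X" "v \<in> A ?k" "z = z'(?k := v)"
    using Suc.prems(3) unfolding grid_def I PiE_insert_eq by auto
  then have "v \<in> B" using Suc.prems(4) unfolding B_def by blast
  then have B1: "1 \<le> card B" using finB by (simp add: Suc_le_eq card_gt_0_iff) blast
  obtain q where le: "card C \<le> d" and q: "poly_fun (d - card C) q"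
    "\<And>x b. x \<in> ?X \<Longrightarrow> f (x(?k := b)) = (\<Prod>c\<in>C. b - c) * q (x(?k := b))"
    using poly_fun_divide_roots[OF finB(2) Suc.prems(2) C0 z'(1), of v] Suc.prems(4) z'(3)
    by blast
  \<comment> \<open>Dropping the last factor lowers the sum by \<open>card B + card C\<close>, and
    division lowers the degree bound by \<open>card C\<close>; so \<open>M\<close> is the target sum
    minus \<open>card B\<close>.\<close>
  define M where "M = (\<Sum>i=1..n. int (card (A i))) - int (d - card C)"
  have "min_prod n (\<lambda>i. card (A i)) M \<le> card {x \<in> ?X. f (x(?k := b)) \<noteq> 0}" if b: "b \<in> B" for b
  proof -
    obtain w where w: "w \<in> ?X" "f (w(?k := b)) \<noteq> 0" using b by (auto simp: B_def)
    \<comment> \<open>As \<open>b\<close> lies outside \<open>C\<close>, the slices of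
      \<open>f\<close> and \<open>q\<close> at \<open>b\<close> differ by a nonzero scalar of the
      domain and have the same nonzeros.\<close>
    have "(\<Prod>c\<in>C. b - c) \<noteq> 0" using b finB by (auto simp: C_def)
    then have "{x \<in> ?X. f (x(?k := b)) \<noteq> 0} = {x \<in> ?X. q (x(?k := b)) \<noteq> 0}"
      using q(2) by auto
    moreover have "q (w(?k := b)) \<noteq> 0" using q(2) w by auto
    ultimately show ?thesis
      using Suc.IH[OF _ poly_fun_upd[OF q(1)] w(1), of ?k b] Suc.prems(1)
      by (simp add: M_def del: fun_upd_apply)
  qed
  then have "card B * min_prod n (\<lambda>i. card (A i)) M
      \<le> (\<Sum>b\<in>B. card {x \<in> ?X. f (x(?k := b)) \<noteq> 0})"
    using sum_bounded_below[of B "min_prod n (\<lambda>i. card (A i)) M"] by simp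
  also have "\<dots> \<le> (\<Sum>b\<in>A ?k. card {x \<in> ?X. f (x(?k := b)) \<noteq> 0})"
    using finB fin by (intro sum_mono2) auto
  also have "\<dots> = card {x \<in> grid ?k A. f x \<noteq> 0}"
    using card_nonzeros_Suc[of n A f] fin by simp
  finally have "card B * min_prod n (\<lambda>i. card (A i)) M \<le> card {x \<in> grid ?k A. f x \<noteq> 0}" .
  moreover define N where "N = (\<Sum>i=1..?k. int (card (A i))) - int d"
  have MN: "M = N - int (card B)" using le cardA by (simp add: M_def N_def)
  \<comment> \<open>The number of nonzero slices is taken as last entry of the tuple.\<close>
  have "min_prod ?k (\<lambda>i. card (A i)) N
      \<le> card B * min_prod n (\<lambda>i. card (A i)) (N - int (card B))"
  proof (rule min_prod_Suc_le)
    show "1 \<le> card (A i)" if "i \<in> {1..?k}" for i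
      using fin[OF that] by (simp add: Suc_le_eq card_gt_0_iff)
    show "card B \<le> card (A ?k)" using cardA by simp
    show "N - int (card B) \<le> (\<Sum>i=1..n. int (card (A i)))" using MN by (simp add: M_def)
  qed (rule B1)
  ultimately show ?case using MN by (simp add: N_def)
qed

section \<open>Covering a grid by hyperplanes\<close>

lemma poly_fun_prod_hyperplanes:
  fixes H :: "nat \<Rightarrow> 'a::idom mpoly"
  assumes "\<And>i. i \<in> {1..d} \<Longrightarrow> hyperplane n (H i)"
  shows "poly_fun d (\<lambda>x. \<Prod>i=1..d. peval x (H i))"
  using assms
proof (induction d)
  case 0
  show ?case by (simp add: poly_fun.const)
next
  case (Suc d)
  obtain c r where H: "H (Suc d) = (\<Sum>i=1..n. pconst (c i) * pvar i) + pconst r"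
    using Suc.prems[of "Suc d"] unfolding hyperplane_def by auto
  have "peval x (H (Suc d)) = (\<Sum>i=1..n. c i * x i) + r" for x
    unfolding H by (rule peval_affine)
  with poly_fun_affine_mult[of d _ c n r] Suc show ?case
    by (simp add: mult.commute)
qed

text \<open>A product in a domain vanishes only if a factor does; this turns covering into a
  question about one polynomial function.\<close>

lemma uncovered_eq_nonzeros:
  "uncovered d H S = {x \<in> S. (\<Prod>i=1..d. peval x (H i)) \<noteq> 0}"
  by (auto simp: uncovered_def covers_point_def)

section \<open>Coordinate hyperplanes that cut out a prescribed subgrid\<close>

lemma hyperplane_pvar_diff:
  assumes "j \<in> {1..n}"
  shows "hyperplane n (pvar j - pconst x :: 'a::idom mpoly)"
proof -
  have "pvar j = (\<Sum>i=1..n. pconst (if i = j then 1 else 0) * pvar i :: 'a mpoly)"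
  proof -
    have "pconst (if i = j then 1 else 0) * pvar i = (if i = j then pvar i else 0 :: 'a mpoly)" for i
      by (simp add: pconst_def flip: single_one)
    then show ?thesis using assms by simp
  qed
  moreover have "- pconst x = pconst (- x)"
    by (simp add: pconst_def single_uminus)
  ultimately show ?thesis
    unfolding hyperplane_def using assms
    by (intro exI[of _ "\<lambda>i. if i = j then 1 else 0"] exI[of _ "- x"]) auto
qed

text \<open>A family must have exactly \<open>e\<close> members even if fewer hyperplanes suffice.
  Surplus indices repeat the last element, so one has to exist.\<close>

lemma finite_surj_atLeastAtMost:
  assumes "finite P" "P \<noteq> {}" "card P \<le> e"
  obtains s where "s ` {1..e} = P"
proof -
  obtain h where h: "bij_betw h {1..card P} P"
    using ex_bij_betw_nat_finite_1[OF assms(1)] by blast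
  have "1 \<le> card P" using assms by (simp add: Suc_le_eq card_gt_0_iff)
  then have "(\<lambda>i. min i (card P)) ` {1..e} = {1..card P}"
    using assms(3) by (force simp: image_iff)
  then have "(\<lambda>i. h (min i (card P))) ` {1..e} = P"
    using h by (metis bij_betw_def image_image)
  then show ?thesis using that by blast
qed

text \<open>Use one hyperplane for each coordinate value removed: a point avoids them all exactly
  when every coordinate stays in \<open>B i\<close>. Repetitions fill the family up to
  \<open>e\<close>.\<close>

lemma cover_complement_of_subgrid:
  fixes A :: "nat \<Rightarrow> 'a::idom set"
  assumes "\<And>i. i \<in> {1..n} \<Longrightarrow> finite (A i)" "\<And>i. i \<in> {1..n} \<Longrightarrow> B i \<subseteq> A i"
    and "1 \<le> (\<Sum>i=1..n. card (A i - B i))" "(\<Sum>i=1..n. card (A i - B i)) \<le> e"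
  obtains G :: "nat \<Rightarrow> 'a mpoly" and j x
  where "\<And>i. i \<in> {1..e} \<Longrightarrow> hyperplane n (G i) \<and> j i \<in> {1..n} \<and> x i \<in> A (j i)
            \<and> G i = pvar (j i) - pconst (x i)"
    and "uncovered e G (grid n A) = grid n B"
proof -
  define P where "P = (SIGMA i:{1..n}. A i - B i)"
  have P: "finite P" "card P = (\<Sum>i=1..n. card (A i - B i))"
    using assms(1) by (auto simp: P_def)
  with assms(3) have "P \<noteq> {}" by (metis card.empty not_one_le_zero)
  with P assms(4) obtain s where s: "s ` {1..e} = P"
    using finite_surj_atLeastAtMost[of P e] by metis
  define G :: "nat \<Rightarrow> 'a mpoly" where "G i = pvar (fst (s i)) - pconst (snd (s i))" for i
  have sP: "s i \<in> P" if "i \<in> {1..e}" for i using s that by blast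
  have "covers_point e G x \<longleftrightarrow> (\<exists>p\<in>P. x (fst p) = snd p)" for x
    unfolding s[symmetric] by (simp add: covers_point_def G_def peval_diff peval_pvar peval_pconst)
  also have "(\<exists>p\<in>P. x (fst p) = snd p) \<longleftrightarrow> (\<exists>i\<in>{1..n}. x i \<in> A i - B i)" for x
    by (force simp: P_def)
  finally have cov: "covers_point e G x \<longleftrightarrow> (\<exists>i\<in>{1..n}. x i \<in> A i - B i)" for x .
  show ?thesis
  proof (rule that[of G "fst \<circ> s" "snd \<circ> s"])
    fix i assume "i \<in> {1..e}"
    with sP show "hyperplane n (G i) \<and> (fst \<circ> s) i \<in> {1..n} \<and> (snd \<circ> s) i \<in> A ((fst \<circ> s) i)
            \<and> G i = pvar ((fst \<circ> s) i) - pconst ((snd \<circ> s) i)"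
      by (fastforce simp: G_def P_def intro: hyperplane_pvar_diff)
  next
    show "uncovered e G (grid n A) = grid n B"
      using assms(2) unfolding uncovered_def cov grid_def set_eq_iff mem_Collect_eq PiE_iff by blast
  qed
qed

text \<open>Choose subsets of sizes \<open>y i\<close>; the two conditions on sums say that between
  1 and \<open>e\<close> values get removed.\<close>

lemma cover_all_but_prod:
  fixes A :: "nat \<Rightarrow> 'a::idom set"
  assumes "\<And>i. i \<in> {1..n} \<Longrightarrow> finite (A i)" "\<And>i. i \<in> {1..n} \<Longrightarrow> y i \<le> card (A i)"
    and "(\<Sum>i=1..n. y i) < (\<Sum>i=1..n. card (A i))"
    and "(\<Sum>i=1..n. card (A i)) \<le> (\<Sum>i=1..n. y i) + e"
  obtains G :: "nat \<Rightarrow> 'a mpoly" and j x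
  where "\<And>i. i \<in> {1..e} \<Longrightarrow> hyperplane n (G i) \<and> j i \<in> {1..n} \<and> x i \<in> A (j i)
            \<and> G i = pvar (j i) - pconst (x i)"
    and "card (uncovered e G (grid n A)) = (\<Prod>i=1..n. y i)"
proof -
  have "\<forall>i\<in>{1..n}. \<exists>B. B \<subseteq> A i \<and> card B = y i"
    using assms(2) by (meson obtain_subset_with_card_n)
  then obtain B where B: "\<And>i. i \<in> {1..n} \<Longrightarrow> B i \<subseteq> A i" "\<And>i. i \<in> {1..n} \<Longrightarrow> card (B i) = y i"
    by metis
  have "(\<Sum>i=1..n. card (A i)) = (\<Sum>i=1..n. y i + card (A i - B i))"
  proof (intro sum.cong refl)
    fix i assume i: "i \<in> {1..n}"
    then have "finite (B i)" using B(1) assms(1) finite_subset by blast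
    then show "card (A i) = y i + card (A i - B i)"
      using i B assms(2) by (simp add: card_Diff_subset)
  qed
  then have "1 \<le> (\<Sum>i=1..n. card (A i - B i))" "(\<Sum>i=1..n. card (A i - B i)) \<le> e"
    using assms(3,4) by (auto simp: sum.distrib)
  from cover_complement_of_subgrid[OF assms(1) B(1) this] obtain G j x
    where "\<And>i. i \<in> {1..e} \<Longrightarrow> hyperplane n (G i) \<and> j i \<in> {1..n} \<and> x i \<in> A (j i)
            \<and> G i = (pvar (j i) - pconst (x i) :: 'a mpoly)"
      and "uncovered e G (grid n A) = grid n B"
    by metis
  moreover have "card (grid n B) = (\<Prod>i=1..n. y i)"
    using B(2) by (simp add: grid_def card_PiE)
  ultimately show ?thesis using that by metis
qed

text \<open>The second conjunct asks for a factor with two elements: on a one-point grid every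
  admissible hyperplane covers the point, whereas \<open>min_prod\<close> is 1 for
  \<open>e \<ge> 1\<close>.\<close>

theorem theorem6p1:
  fixes n d :: nat
    and A :: "nat \<Rightarrow> 'a::idom set"
    and H :: "nat \<Rightarrow> 'a mpoly"
  assumes "n \<ge> 1"
    and "\<And>i. i \<in> {1..n} \<Longrightarrow> finite (A i) \<and> A i \<noteq> {}"
    and "\<And>i. i \<in> {1..d} \<Longrightarrow> hyperplane n (H i)"
  shows "(partially_covers d H (grid n A) \<longrightarrow>
            card (uncovered d H (grid n A))
              \<ge> min_prod n (\<lambda>i. card (A i)) ((\<Sum>i=1..n. int (card (A i))) - int d))
       \<and> ((\<exists>i\<in>{1..n}. card (A i) \<ge> 2) \<longrightarrow>
            (\<forall>e::nat. e \<ge> 1 \<longrightarrow>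
              (\<exists>(G :: nat \<Rightarrow> 'a mpoly) (j :: nat \<Rightarrow> nat) (x :: nat \<Rightarrow> 'a).
                 (\<forall>i\<in>{1..e}. hyperplane n (G i) \<and> j i \<in> {1..n} \<and> x i \<in> A (j i)
                              \<and> G i = pvar (j i) - pconst (x i))
                 \<and> card (uncovered e G (grid n A))
                     = min_prod n (\<lambda>i. card (A i)) ((\<Sum>i=1..n. int (card (A i))) - int e))))
       \<and> (card (uncovered d H (grid n A)) = 1 \<longrightarrow> d \<ge> (\<Sum>i=1..n. (card (A i) - 1)))"
proof -
  have card1: "1 \<le> card (A i)" if "i \<in> {1..n}" for i
    using assms(2)[OF that] by (simp add: Suc_le_eq card_gt_0_iff)
  let ?a = "\<lambda>i. card (A i)"
  \<comment> \<open>Shared by (a) and (c): any uncovered point is the nonzero that Alon-Fueredi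
    starts from.\<close>
  have bound: "min_prod n ?a ((\<Sum>i=1..n. int (?a i)) - int d) \<le> card (uncovered d H (grid n A))"
    if "uncovered d H (grid n A) \<noteq> {}"
    using that alon_fueredi[of n A, OF assms(2) poly_fun_prod_hyperplanes[of d n H, OF assms(3)]]
    unfolding uncovered_eq_nonzeros by blast
  have "uncovered d H (grid n A) \<noteq> {}" if "partially_covers d H (grid n A)"
    using that by (auto simp: partially_covers_def covers_def uncovered_def)
  moreover have "\<exists>(G :: nat \<Rightarrow> 'a mpoly) (j :: nat \<Rightarrow> nat) (x :: nat \<Rightarrow> 'a).
                 (\<forall>i\<in>{1..e}. hyperplane n (G i) \<and> j i \<in> {1..n} \<and> x i \<in> A (j i)
                              \<and> G i = pvar (j i) - pconst (x i))
                 \<and> card (uncovered e G (grid n A))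
                     = min_prod n ?a ((\<Sum>i=1..n. int (?a i)) - int e)"
    if i: "\<exists>i\<in>{1..n}. 2 \<le> card (A i)" and e: "1 \<le> e" for e
  proof -
    define N where "N = (\<Sum>i=1..n. int (?a i)) - int e"
    \<comment> \<open>Side lengths of the subgrid to be left uncovered: optimal in product, and
      short of the full total by at least 1 and at most \<open>e\<close>.\<close>
    have "\<exists>y. (\<forall>i\<in>{1..n}. y i \<le> ?a i) \<and> (\<Sum>i=1..n. y i) < (\<Sum>i=1..n. ?a i)
        \<and> (\<Sum>i=1..n. ?a i) \<le> (\<Sum>i=1..n. y i) + e \<and> min_prod n ?a N = (\<Prod>i=1..n. y i)"
    proof (cases "int n \<le> N")
      case True
      have "N \<le> (\<Sum>i=1..n. int (?a i))" by (simp add: N_def)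
      from min_prod_attained[of n ?a, OF card1 True this] obtain y
        where y: "y \<in> compositions n ?a N" "min_prod n ?a N = (\<Prod>i=1..n. y i)" by auto
      have "int (\<Sum>i=1..n. y i) = int (\<Sum>i=1..n. ?a i) - int e"
        using y(1) by (simp add: compositions_def N_def)
      then have "(\<Sum>i=1..n. ?a i) = (\<Sum>i=1..n. y i) + e" by linarith
      with y e show ?thesis
        by (intro exI[of _ y]) (auto simp: compositions_def PiE_iff)
    next
      \<comment> \<open>The default value 1 is realised by leaving a single point. This removes
        fewer than \<open>e\<close> values, and at least one thanks to the factor with two
        elements.\<close>
      case False
      obtain k where k: "k \<in> {1..n}" "1 < ?a k" using i by fastforce
      then have "(\<Sum>i=1..n. 1) < (\<Sum>i=1..n. ?a i)"
        using card1 by (intro sum_strict_mono_ex1) blast+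
      moreover from False have "int (\<Sum>i=1..n. ?a i) < int (n + e)" by (simp add: N_def)
      then have "(\<Sum>i=1..n. ?a i) < n + e" by (simp only: of_nat_less_iff)
      ultimately show ?thesis
        using card1 False by (intro exI[of _ "\<lambda>i. 1"]) (auto simp: min_prod_def)
    qed
    then obtain y where y: "\<And>i. i \<in> {1..n} \<Longrightarrow> y i \<le> ?a i" "(\<Sum>i=1..n. y i) < (\<Sum>i=1..n. ?a i)"
        "(\<Sum>i=1..n. ?a i) \<le> (\<Sum>i=1..n. y i) + e" "min_prod n ?a N = (\<Prod>i=1..n. y i)"
      by blast
    have "finite (A i)" if "i \<in> {1..n}" for i using assms(2) that by blast
    from cover_all_but_prod[of n A y e, OF this y(1-3)] obtain G :: "nat \<Rightarrow> 'a mpoly" and j x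
      where G: "\<And>i. i \<in> {1..e} \<Longrightarrow> hyperplane n (G i) \<and> j i \<in> {1..n} \<and> x i \<in> A (j i)
            \<and> G i = pvar (j i) - pconst (x i)"
        "card (uncovered e G (grid n A)) = (\<Prod>i=1..n. y i)"
      by blast
    show ?thesis
    proof (intro exI[of _ G] exI[of _ j] exI[of _ x] conjI[OF ballI])
      show "card (uncovered e G (grid n A)) = min_prod n ?a ((\<Sum>i=1..n. int (?a i)) - int e)"
        using G(2) y(4) by (simp only: N_def)
    qed (rule G(1))
  qed
  \<comment> \<open>If \<open>d\<close> were smaller, the sum in \<open>min_prod\<close> would
    exceed \<open>n\<close>, and at least two points would stay uncovered.\<close>
  moreover have "(\<Sum>i=1..n. ?a i - 1) \<le> d" if one: "card (uncovered d H (grid n A)) = 1"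
  proof (rule ccontr)
    assume "\<not> ?thesis"
    moreover have "(\<Sum>i=1..n. ?a i) = (\<Sum>i=1..n. (?a i - 1) + 1)"
      using card1 by (intro sum.cong refl) (metis le_add_diff_inverse2)
    then have "(\<Sum>i=1..n. ?a i) = (\<Sum>i=1..n. ?a i - 1) + n"
      by (simp only: sum.distrib) simp
    ultimately have "n + d < (\<Sum>i=1..n. ?a i)" by linarith
    then have "int n + int d < (\<Sum>i=1..n. int (?a i))"
      by (metis of_nat_add of_nat_less_iff of_nat_sum)
    then have "2 \<le> min_prod n ?a ((\<Sum>i=1..n. int (?a i)) - int d)"
      using card1 by (intro min_prod_ge_2) auto
    moreover have "uncovered d H (grid n A) \<noteq> {}" using one by auto
    ultimately show False using bound one by simp
  qed
  ultimately show ?thesis using bound by blast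
qed

end
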